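(* Let $n\ge4$ be an integer. The distance spectrum of the torch graph $O_n$ (the multiset of eigenvalues of its distance matrix $D(O_n)$, superscripts denoting multiplicities) is $$\operatorname{Spec}_D(O_n)=\left\{(-2)^{\,n-3},\ -1,\ \lambda_1,\ldots,\lambda_6\right\},$$ where $\lambda_1,\ldots,\lambda_6$ are the roots (with multiplicity) of $$p(x)=x^6-(2n-5)x^5-(43n-63)x^4-(123n-103)x^3-(76n+174)x^2+(10n-276)x+12n-88.$$
   Context: The distance matrix of a connected graph $\Gamma$ is $D(\Gamma)=(d(u,v))_{u,v\in V(\Gamma)}$, where $d$ is the shortest-path distance. For $n\ge 4$, the torch graph $O_n$ is the simple graph on the $n+4$ vertices $v_1,\dots,v_{n+4}$ with exactly the following edges: $v_{n+1}v_{n+3}$; $v_{n+1}v_i$ and $v_{n+3}v_i$ for every $2\le i\le n-2$; $v_1v_{n+1}$ and $v_1v_{n+3}$; $v_1v_{n+2}$ and $v_1v_{n+4}$; $v_nv_1$, $v_nv_{n+2}$ and $v_nv_{n+4}$; and $v_nv_{n-1}$. *)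

theory Defs
  imports
    "Graph_Theory.Pair_Digraph"
    "Graph_Theory.Digraph_Component"
    "Graph_Theory.Shortest_Path"
    "Jordan_Normal_Form.Spectral_Radius"
begin

text \<open>
  Simple graphs are finite symmetric loop-free digraphs whose arcs are ordered pairs of vertices
  (locale \<open>pair_graph\<close>).  Shortest-path distance is the shortest-path cost \<open>\<mu>\<close> for unit arc
  weights.  It is finite exactly when the second vertex is reachable from the first, so
  \<open>graph_dist\<close> is meaningful only within a connected component.
\<close>

definition graph_dist :: "'a pair_pre_digraph \<Rightarrow> 'a \<Rightarrow> 'a \<Rightarrow> real" where
  "graph_dist G u v = real_of_ereal (wf_digraph.\<mu> (with_proj G) (\<lambda>_. 1) u v)"

text \<open>
  Matrices are indexed by \<open>{0..<N}\<close>, so the finite vertex set is enumerated in increasing order.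
\<close>

definition distance_matrix :: "'a::linorder pair_pre_digraph \<Rightarrow> real mat" where
  "distance_matrix G =
     (let vs = sorted_list_of_set (pverts G); N = length vs
      in mat N N (\<lambda>(i, j). graph_dist G (vs ! i) (vs ! j)))"

text \<open>
  The multiset of all complex eigenvalues of a square matrix, with algebraic multiplicities
  (for real symmetric matrices the geometric ones are the same).
\<close>

definition eigenvalues_mset :: "complex mat \<Rightarrow> complex multiset" where
  "eigenvalues_mset A = (\<Sum>a\<in>spectrum A. replicate_mset (order a (char_poly A)) a)"

definition distance_spectrum :: "'a::linorder pair_pre_digraph \<Rightarrow> complex multiset" where
  "distance_spectrum G = eigenvalues_mset (map_mat complex_of_real (distance_matrix G))"

text \<open>The torch graph, for \<open>n \<ge> 4\<close>; the number \<open>i\<close> stands for the vertex \<open>v\<^sub>i\<close>.\<close>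

definition torch_edges :: "nat \<Rightarrow> nat rel" where
  "torch_edges n =
     {(n + 1, n + 3)}
     \<union> (\<Union>i\<in>{2..n - 2}. {(n + 1, i), (n + 3, i)})
     \<union> {(1, n + 1), (1, n + 3)}
     \<union> {(1, n + 2), (1, n + 4)}
     \<union> {(n, 1), (n, n + 2), (n, n + 4)}
     \<union> {(n, n - 1)}"

definition torch_graph :: "nat \<Rightarrow> nat pair_pre_digraph" where
  "torch_graph n = \<lparr> pverts = {1..n + 4}, parcs = torch_edges n \<union> (torch_edges n)\<inverse> \<rparr>"

lemma pair_graph_torch_graph:
  assumes "n \<ge> 4"
  shows "pair_graph (torch_graph n)"
proof
  show "finite (parcs (torch_graph n))"
    by (auto simp: torch_graph_def torch_edges_def)
  show "symmetric (with_proj (torch_graph n))"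
    by (auto simp: symmetric_def sym_def torch_graph_def)
qed (use assms in \<open>auto simp: torch_graph_def torch_edges_def\<close>)

lemma connected_torch_graph:
  assumes "n \<ge> 4"
  shows "Digraph_Component.connected (with_proj (torch_graph n))"
proof -
  interpret pair_graph "torch_graph n"
    using assms by (rule pair_graph_torch_graph)
  have adj: "u \<rightarrow>\<^sup>*\<^bsub>with_proj (torch_graph n)\<^esub> v" if "(u, v) \<in> torch_edges n" for u v
    using that by (intro reachable_adjI) (simp add: torch_graph_def)
  have e: "(1, n + 1) \<in> torch_edges n" "(1, n + 2) \<in> torch_edges n" "(1, n + 3) \<in> torch_edges n"
    "(1, n + 4) \<in> torch_edges n" "(n, 1) \<in> torch_edges n" "(n, n - 1) \<in> torch_edges n"
    "\<And>i. i \<in> {2..n - 2} \<Longrightarrow> (n + 1, i) \<in> torch_edges n"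
    by (auto simp: torch_edges_def)
  note r = e[THEN adj]
  have rn: "1 \<rightarrow>\<^sup>*\<^bsub>with_proj (torch_graph n)\<^esub> n"
    using r(5) by (rule symmetric_reachable[OF sym_arcs])
  have *: "1 \<rightarrow>\<^sup>*\<^bsub>with_proj (torch_graph n)\<^esub> v" if v: "v \<in> {1..n + 4}" for v
  proof -
    consider "v = 1" | "v \<in> {2..n - 2}" | "v = n - 1" | "v = n" | "v = n + 1" | "v = n + 2"
      | "v = n + 3" | "v = n + 4"
      using v unfolding atLeastAtMost_iff by linarith
    then show ?thesis
    proof cases
      case 1
      have "1 \<in> pverts (torch_graph n)"
        by (simp add: torch_graph_def)
      with 1 show ?thesis by (simp only: reachable_refl)
    next
      case 2
      then show ?thesis using reachable_trans[OF r(1) r(7)] by blast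
    next
      case 3
      then show ?thesis using reachable_trans[OF rn r(6)] by blast
    qed (use r(1-4) rn in blast)+
  qed
  have reach: "u \<rightarrow>\<^sup>*\<^bsub>with_proj (torch_graph n)\<^esub> v" if "u \<in> {1..n + 4}" "v \<in> {1..n + 4}" for u v
    using symmetric_reachable[OF sym_arcs *[OF that(1)]] *[OF that(2)] by (rule reachable_trans)
  have "(parcs (torch_graph n))\<^sup>s = parcs (torch_graph n)"
    by (auto simp: symcl_def torch_graph_def)
  then show ?thesis
    using reach by (auto simp: connected_conv reachable_def torch_graph_def)
qed

end

theory Submission
  imports Defs
begin

text \<open>
  The vertices of the torch graph fall into six classes of twins, namely \<open>{v\<^sub>1}\<close>,
  \<open>{v\<^sub>2, \<dots>, v\<^bsub>n-2\<^esub>}\<close>, \<open>{v\<^bsub>n-1\<^esub>}\<close>, \<open>{v\<^sub>n}\<close>, \<open>{v\<^bsub>n+1\<^esub>, v\<^bsub>n+3\<^esub>}\<close> and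
  \<open>{v\<^bsub>n+2\<^esub>, v\<^bsub>n+4\<^esub>}\<close>, and the distance between two different vertices depends on their
  classes only.  The distances are certified without enumerating walks: a function that grows by at
  most one along every arc bounds distances from below, and one that drops by one at a suitable
  neighbour of every vertex other than the source bounds them from above
  (\<open>graph_dist_eqI\<close>).

  So if \<open>M\<close> is the \<open>6 \<times> 6\<close> table of distances between classes, \<open>Z\<close> the vertex-class incidence
  matrix and \<open>\<Delta>\<close> the diagonal matrix with entry \<open>x + M\<^bsub>kk\<^esub>\<close> at the vertices of class \<open>k\<close>, then
  \<open>x I - D = \<Delta> - Z M Z\<^sup>T\<close>.  A block matrix factored in two ways (\<open>det_twin_classes\<close>) reduces the
  determinant of this matrix to that of the quotient \<open>diag (x + M\<^bsub>kk\<^esub>) - M S\<close>, where \<open>S\<close> is the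
  diagonal matrix of the class sizes \<open>1, n - 3, 1, 1, 2, 2\<close>: a class of size \<open>s\<close> contributes the
  further factor \<open>(x + M\<^bsub>kk\<^esub>) ^ (s - 1)\<close>.  Two vertices of the same class are at distance two,
  except for the adjacent pair \<open>v\<^bsub>n+1\<^esub>, v\<^bsub>n+3\<^esub>\<close>, so these factors are
  \<open>(x + 2) ^ (n - 4)\<close>, \<open>x + 1\<close> and \<open>x + 2\<close>.  They account for the eigenvalue \<open>-2\<close> with multiplicity
  \<open>n - 3\<close> and for the eigenvalue \<open>-1\<close>; the quotient determinant is the stated polynomial of degree
  six (\<open>det_torch_quotient\<close>).
\<close>

section \<open>Certifying distances by a potential\<close>

lemma (in pair_wf_digraph) graph_dist_eqI:
  fixes f :: "'a \<Rightarrow> nat"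
  assumes u: "u \<in> pverts G" and v: "v \<in> pverts G" and fu: "f u = 0"
    and step: "\<And>x y. (x, y) \<in> parcs G \<Longrightarrow> f y \<le> Suc (f x)"
    and pred: "\<And>y. y \<in> pverts G \<Longrightarrow> y \<noteq> u \<Longrightarrow> \<exists>x. (x, y) \<in> parcs G \<and> f y = Suc (f x)"
  shows "graph_dist G u v = real (f v)"
proof -
  have cost: "awalk_cost (\<lambda>_. 1) p = real (length p)" for p :: "('a \<times> 'a) list"
    by (induction p) auto
  have lower: "f y \<le> f x + length p" if "awalk x p y" for x p y
    using that
  proof (induction p arbitrary: x)
    case Nil
    then show ?case by (simp add: awalk_Nil_iff)
  next
    case (Cons e p)
    then have e: "(x, snd e) \<in> parcs G" and p: "awalk (snd e) p y"
      by (auto simp: awalk_Cons_iff)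
    show ?case using Cons.IH[OF p] step[OF e] by simp
  qed
  have upper: "\<exists>p. awalk u p y \<and> length p = f y" if "y \<in> pverts G" for y
    using that
  proof (induction "f y" arbitrary: y rule: less_induct)
    case less
    show ?case
    proof (cases "y = u")
      case True
      then show ?thesis using u fu by (auto simp: awalk_Nil_iff intro!: exI[of _ "[]"])
    next
      case False
      then obtain x where x: "(x, y) \<in> parcs G" "f y = Suc (f x)"
        using pred less.prems by blast
      then have "x \<in> pverts G"
        using in_arcsD1 by blast
      with less.hyps[of x] x obtain p where p: "awalk u p x" "length p = f x"
        by auto
      moreover have "awalk x [(x, y)] y"
        using arc_implies_awalk[of "(x, y)"] x by simp
      ultimately have "awalk u (p @ [(x, y)]) y"
        by (meson awalk_appendI)
      with p x show ?thesis by (intro exI[of _ "p @ [(x, y)]"]) simp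
    qed
  qed
  obtain p where p: "awalk u p v" "length p = f v"
    using upper[OF v] by blast
  have "\<mu> (\<lambda>_. 1) u v = ereal (real (f v))"
  proof (rule antisym)
    show "\<mu> (\<lambda>_. 1) u v \<le> ereal (real (f v))"
      using min_cost_le_walk_cost[OF p(1), of "\<lambda>_. 1"] p(2) by (simp add: cost)
    show "ereal (real (f v)) \<le> \<mu> (\<lambda>_. 1) u v"
      unfolding \<mu>_def using lower fu by (intro INF_greatest) (fastforce simp: cost)
  qed
  then show ?thesis by (simp add: graph_dist_def)
qed

section \<open>Distances in the torch graph\<close>

definition torch_class :: "nat \<Rightarrow> nat \<Rightarrow> nat" where
  "torch_class n v =
     (if v = 1 then 0 else if v \<le> n - 2 then 1 else if v = n - 1 then 2 else if v = n then 3
      else if v = n + 1 \<or> v = n + 3 then 4 else 5)"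

text \<open>
  A diagonal entry is the distance between any two different vertices of the class; it is set to
  \<open>0\<close> for the classes \<open>0\<close>, \<open>2\<close> and \<open>3\<close>, which have a single vertex for every \<open>n\<close>.
\<close>

definition torch_quotient :: "nat list list" where
  "torch_quotient =
     [[0, 2, 2, 1, 1, 1],
      [2, 2, 4, 3, 1, 3],
      [2, 4, 0, 1, 3, 2],
      [1, 3, 1, 0, 2, 1],
      [1, 1, 3, 2, 1, 2],
      [1, 3, 2, 1, 2, 2]]"

definition torch_dist :: "nat \<Rightarrow> nat \<Rightarrow> nat \<Rightarrow> nat" where
  "torch_dist n u v =
     (if u = v then 0 else torch_quotient ! torch_class n u ! torch_class n v)"

lemma torch_class_less: "torch_class n v < 6"
  by (simp add: torch_class_def)

lemma torch_vertex_cases: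
  assumes "n \<ge> 4" "v \<in> {1..n + 4}"
  obtains "v = 1" "torch_class n v = 0" | "v \<in> {2..n - 2}" "torch_class n v = 1"
    | "v = n - 1" "torch_class n v = 2" | "v = n" "torch_class n v = 3"
    | "v = n + 1" "torch_class n v = 4" | "v = n + 3" "torch_class n v = 4"
    | "v = n + 2" "torch_class n v = 5" | "v = n + 4" "torch_class n v = 5"
proof -
  consider "v = 1" | "v \<in> {2..n - 2}" | "v = n - 1" | "v = n" | "v = n + 1" | "v = n + 3"
    | "v = n + 2" | "v = n + 4"
    using assms(2) unfolding atLeastAtMost_iff by linarith
  moreover have cls: "torch_class n 1 = 0" "torch_class n (n - 1) = 2" "torch_class n n = 3"
    "torch_class n (n + 1) = 4" "torch_class n (n + 3) = 4"
    "torch_class n (n + 2) = 5" "torch_class n (n + 4) = 5"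
    using assms(1) by (auto simp: torch_class_def)
  ultimately show ?thesis
  proof cases
    case 2
    moreover from 2 have "torch_class n v = 1"
      using assms(1) by (auto simp: torch_class_def)
    ultimately show ?thesis using that by blast
  qed (use that cls in blast)+
qed

lemma torch_arc_iff:
  assumes "n \<ge> 4" "u \<in> {1..n + 4}" "v \<in> {1..n + 4}" "u \<noteq> v"
  shows "(u, v) \<in> parcs (torch_graph n) \<longleftrightarrow>
    torch_quotient ! torch_class n u ! torch_class n v = 1"
  by (rule torch_vertex_cases[OF assms(1,2)]; rule torch_vertex_cases[OF assms(1,3)])
    (use assms(1,4) in \<open>auto simp: torch_graph_def torch_edges_def torch_quotient_def\<close>)

lemma torch_quotient_nonzero:
  assumes "n \<ge> 4" "u \<in> {1..n + 4}" "v \<in> {1..n + 4}" "u \<noteq> v"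
  shows "torch_quotient ! torch_class n u ! torch_class n v \<noteq> 0"
  by (rule torch_vertex_cases[OF assms(1,2)]; rule torch_vertex_cases[OF assms(1,3)])
    (use assms(1,4) in \<open>auto simp: torch_quotient_def\<close>)

lemma torch_quotient_step:
  assumes "a < 6" "b < 6" "c < 6" "torch_quotient ! b ! c = 1"
  shows "torch_quotient ! a ! c \<le> Suc (torch_quotient ! a ! b)"
proof -
  have "\<forall>a\<in>set [0..<6]. \<forall>b\<in>set [0..<6]. \<forall>c\<in>set [0..<6]. torch_quotient ! b ! c = 1 \<longrightarrow>
      torch_quotient ! a ! c \<le> Suc (torch_quotient ! a ! b)"
    by code_simp
  with assms show ?thesis by auto
qed

text \<open>
  The last arc of a shortest path of length at least two can be taken to leave \<open>v\<^sub>1\<close>, \<open>v\<^sub>n\<close>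
  or \<open>v\<^bsub>n+1\<^esub>\<close>, the representatives of the classes \<open>0\<close>, \<open>3\<close> and \<open>4\<close>.
\<close>

lemma torch_quotient_pred:
  assumes "a < 6" "b < 6" "torch_quotient ! a ! b \<ge> 2"
  shows "\<exists>c\<in>{0, 3, 4}. torch_quotient ! c ! b = 1 \<and>
    torch_quotient ! a ! b = Suc (torch_quotient ! a ! c)"
proof -
  have "\<forall>a\<in>set [0..<6]. \<forall>b\<in>set [0..<6]. torch_quotient ! a ! b \<ge> 2 \<longrightarrow>
      (\<exists>c\<in>set [0, 3, 4]. torch_quotient ! c ! b = 1 \<and>
        torch_quotient ! a ! b = Suc (torch_quotient ! a ! c))"
    by code_simp
  with assms show ?thesis by auto
qed

lemma graph_dist_torch_graph:
  assumes n: "n \<ge> 4" and u: "u \<in> {1..n + 4}" and v: "v \<in> {1..n + 4}"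
  shows "graph_dist (torch_graph n) u v = real (torch_dist n u v)"
proof -
  interpret pair_graph "torch_graph n"
    using n by (rule pair_graph_torch_graph)
  have V: "pverts (torch_graph n) = {1..n + 4}"
    by (simp add: torch_graph_def)
  let ?c = "torch_class n"
  show ?thesis
  proof (rule graph_dist_eqI)
    show "u \<in> pverts (torch_graph n)" "v \<in> pverts (torch_graph n)"
      using u v by (simp_all only: V)
    show "torch_dist n u u = 0"
      by (simp add: torch_dist_def)
  next
    fix x y assume xy: "(x, y) \<in> parcs (torch_graph n)"
    then have mem: "x \<in> {1..n + 4}" "y \<in> {1..n + 4}" "x \<noteq> y"
      using in_arcsD1[OF xy] in_arcsD2[OF xy] no_loops'[of x] unfolding V by auto
    with xy have "torch_quotient ! ?c x ! ?c y = 1"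
      using torch_arc_iff[OF n] by blast
    then show "torch_dist n u y \<le> Suc (torch_dist n u x)"
      using torch_quotient_step[OF torch_class_less torch_class_less torch_class_less, of n x n y n u]
      by (auto simp: torch_dist_def)
  next
    fix y assume "y \<in> pverts (torch_graph n)" and ne: "y \<noteq> u"
    then have y: "y \<in> {1..n + 4}"
      by (simp only: V)
    let ?m = "torch_quotient ! ?c u ! ?c y"
    show "\<exists>x. (x, y) \<in> parcs (torch_graph n) \<and> torch_dist n u y = Suc (torch_dist n u x)"
    proof (cases "?m = 1")
      case True
      with ne y u have "(u, y) \<in> parcs (torch_graph n)"
        using torch_arc_iff[OF n] by blast
      with True ne show ?thesis
        by (intro exI[of _ u]) (simp add: torch_dist_def)
    next
      case False
      with torch_quotient_nonzero[OF n u y] ne have m: "?m \<ge> 2"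
        by linarith
      then obtain c where c: "c \<in> {0, 3, 4}" "torch_quotient ! c ! ?c y = 1"
          "?m = Suc (torch_quotient ! ?c u ! c)"
        using torch_quotient_pred[OF torch_class_less torch_class_less] by blast
      obtain x where x: "x \<in> {1..n + 4}" "?c x = c"
      proof -
        have "?c 1 = 0" "?c n = 3" "?c (n + 1) = 4"
          using n by (auto simp: torch_class_def)
        with c(1) n that[of 1] that[of n] that[of "n + 1"] show ?thesis
          by auto
      qed
      have "x \<noteq> u" "x \<noteq> y"
        using c m x(2) by auto
      then have "(x, y) \<in> parcs (torch_graph n)"
        using torch_arc_iff[OF n x(1) y] c(2) x(2) by simp
      with \<open>x \<noteq> u\<close> ne x(2) c(3) show ?thesis
        by (intro exI[of _ x]) (simp add: torch_dist_def)
    qed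
  qed
qed

lemma distance_matrix_torch_graph:
  assumes "n \<ge> 4"
  shows "distance_matrix (torch_graph n) =
    mat (n + 4) (n + 4) (\<lambda>(i, j). real (torch_dist n (Suc i) (Suc j)))"
proof -
  have "sorted_list_of_set {1..n + 4} = [1..<Suc (n + 4)]"
    by (metis atLeastLessThanSuc_atLeastAtMost sorted_list_of_set_range)
  moreover have "pverts (torch_graph n) = {1..n + 4}"
    by (simp add: torch_graph_def)
  ultimately have vs: "sorted_list_of_set (pverts (torch_graph n)) = [1..<Suc (n + 4)]"
    by (simp only:)
  show ?thesis
    unfolding distance_matrix_def vs Let_def
    by (rule eq_matI) (auto simp: graph_dist_torch_graph[OF assms] simp del: upt_Suc)
qed

lemma card_torch_class:
  assumes "n \<ge> 4" "l < 6"
  shows "card {i. i < n + 4 \<and> torch_class n (Suc i) = l} = [1, n - 3, 1, 1, 2, 2] ! l"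
proof -
  have "{i. i < n + 4 \<and> torch_class n (Suc i) = 0} = {0}"
    "{i. i < n + 4 \<and> torch_class n (Suc i) = 1} = {1..<n - 2}"
    "{i. i < n + 4 \<and> torch_class n (Suc i) = 2} = {n - 2}"
    "{i. i < n + 4 \<and> torch_class n (Suc i) = 3} = {n - 1}"
    "{i. i < n + 4 \<and> torch_class n (Suc i) = 4} = {n, n + 2}"
    "{i. i < n + 4 \<and> torch_class n (Suc i) = 5} = {n + 1, n + 3}"
    using assms(1) by (auto simp: torch_class_def split: if_splits)
  moreover have "l = 0 \<or> l = 1 \<or> l = 2 \<or> l = 3 \<or> l = 4 \<or> l = 5"
    using assms(2) by linarith
  ultimately show ?thesis by auto
qed

section \<open>Determinants of matrices that are constant on classes\<close>

text \<open>
  With \<open>Z\<close> the incidence matrix of the classes, \<open>\<Delta>\<close> and \<open>D\<close> the diagonal matrices of \<open>d\<close> on indices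
  and on classes, \<open>\<Delta> Z = Z D\<close> holds.  Hence multiplying the block matrix with rows \<open>\<Delta>, Z D\<close> and
  \<open>M Z\<^sup>T, D\<close> from either side by the unipotent one with upper right block \<open>- Z\<close> clears its
  upper right block; the remaining diagonal blocks are \<open>\<Delta>\<close> and \<open>D - M Z\<^sup>T Z\<close> in one case, and
  \<open>\<Delta> - Z M Z\<^sup>T\<close> and \<open>D\<close> in the other.  Keeping both diagonal factors avoids divisions, so the
  identity can be used over polynomials.
\<close>

lemma det_twin_classes:
  fixes M :: "nat \<Rightarrow> nat \<Rightarrow> 'a::idom" and d :: "nat \<Rightarrow> 'a" and c :: "nat \<Rightarrow> nat"
  assumes c: "\<And>i. i < N \<Longrightarrow> c i < r"
  defines "s \<equiv> \<lambda>l. card {i. i < N \<and> c i = l}"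
  shows "(\<Prod>l<r. d l) *
      det (mat N N (\<lambda>(i, j). (if i = j then d (c i) else 0) - M (c i) (c j))) =
    (\<Prod>l<r. d l ^ s l) *
      det (mat r r (\<lambda>(k, l). (if k = l then d k else 0) - M k l * of_nat (s l)))"
    (is "_ * det ?B = _ * det ?Q")
proof -
  define \<Delta> where "\<Delta> = mat N N (\<lambda>(i, j). if i = j then d (c i) else 0)"
  define D where "D = mat r r (\<lambda>(k, l). if k = l then d k else 0)"
  \<comment> \<open>\<open>W\<close>, \<open>P\<close> and \<open>R\<close> are \<open>- Z\<close>, \<open>Z D\<close> and \<open>M Z\<^sup>T\<close>.\<close>
  define W where "W = mat N r (\<lambda>(i, l). if c i = l then - 1 else 0 :: 'a)"
  define P where "P = mat N r (\<lambda>(i, l). if c i = l then d l else 0)"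
  define R where "R = mat r N (\<lambda>(k, j). M k (c j))"
  define K where "K = four_block_mat \<Delta> P R D"
  define U where "U = four_block_mat (1\<^sub>m N) W (0\<^sub>m r N) (1\<^sub>m r)"
  have car: "\<Delta> \<in> carrier_mat N N" "D \<in> carrier_mat r r" "W \<in> carrier_mat N r"
    "P \<in> carrier_mat N r" "R \<in> carrier_mat r N" "?B \<in> carrier_mat N N" "?Q \<in> carrier_mat r r"
    "K \<in> carrier_mat (N + r) (N + r)" "U \<in> carrier_mat (N + r) (N + r)"
    by (auto simp: \<Delta>_def D_def W_def P_def R_def K_def U_def)
  have det_U: "det U = 1"
    unfolding U_def using car by (subst det_four_block_mat_lower_left_zero[of _ N _ r]) auto
  have \<Delta>W: "\<Delta> * W + P = 0\<^sub>m N r"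
    by (rule eq_matI)
      (auto simp: \<Delta>_def W_def P_def scalar_prod_def if_distrib[of "\<lambda>x. x * _"] cong: if_cong)
  have WD: "P + W * D = 0\<^sub>m N r"
    by (rule eq_matI)
      (auto simp: D_def W_def P_def scalar_prod_def if_distrib[of "\<lambda>x. _ * x"] cong: if_cong)
  have RW: "R * W + D = ?Q"
  proof (rule eq_matI)
    fix k l assume "k < dim_row ?Q" "l < dim_col ?Q"
    then have kl: "k < r" "l < r" by auto
    have "(\<Sum>j = 0..<N. M k (c j) * (if c j = l then - 1 else 0))
        = (\<Sum>j\<in>{i. i < N \<and> c i = l}. - M k l)"
      by (rule sum.mono_neutral_cong_right) auto
    also have "\<dots> = - (M k l * of_nat (s l))"
      by (simp add: s_def mult.commute)
    finally show "(R * W + D) $$ (k, l) = ?Q $$ (k, l)"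
      using kl by (simp add: R_def W_def D_def scalar_prod_def)
  qed (auto simp: R_def W_def D_def)
  have WR: "\<Delta> + W * R = ?B"
  proof (rule eq_matI)
    fix i j assume "i < dim_row ?B" "j < dim_col ?B"
    then have ij: "i < N" "j < N" by auto
    have "(\<Sum>l = 0..<r. (if c i = l then - 1 else 0) * M l (c j))
        = (\<Sum>l = 0..<r. if l = c i then - M (c i) (c j) else 0)"
      by (rule sum.cong) auto
    also have "\<dots> = - M (c i) (c j)"
      using c[OF ij(1)] by simp
    finally show "(\<Delta> + W * R) $$ (i, j) = ?B $$ (i, j)"
      using ij by (simp add: R_def W_def \<Delta>_def scalar_prod_def)
  qed (auto simp: R_def W_def \<Delta>_def)
  have "K * U = four_block_mat (\<Delta> * 1\<^sub>m N + P * 0\<^sub>m r N) (\<Delta> * W + P * 1\<^sub>m r)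
      (R * 1\<^sub>m N + D * 0\<^sub>m r N) (R * W + D * 1\<^sub>m r)"
    unfolding K_def U_def using car by (intro mult_four_block_mat) auto
  also have "\<dots> = four_block_mat \<Delta> (0\<^sub>m N r) R ?Q"
    using car \<Delta>W RW by simp
  finally have KU: "K * U = four_block_mat \<Delta> (0\<^sub>m N r) R ?Q" .
  have "U * K = four_block_mat (1\<^sub>m N * \<Delta> + W * R) (1\<^sub>m N * P + W * D)
      (0\<^sub>m r N * \<Delta> + 1\<^sub>m r * R) (0\<^sub>m r N * P + 1\<^sub>m r * D)"
    unfolding K_def U_def using car by (intro mult_four_block_mat) auto
  also have "\<dots> = four_block_mat ?B (0\<^sub>m N r) R D"
    using car WD WR by simp
  finally have UK: "U * K = four_block_mat ?B (0\<^sub>m N r) R D" .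
  have "det D * det ?B = det (U * K)"
    unfolding UK using car by (subst det_four_block_mat_upper_right_zero[of _ N _ r]) auto
  also have "\<dots> = det (K * U)"
    using car by (simp add: det_mult)
  also have "\<dots> = det \<Delta> * det ?Q"
    unfolding KU using car by (subst det_four_block_mat_upper_right_zero[of _ N _ r]) auto
  also have "det D = (\<Prod>l<r. d l)"
  proof -
    have "det D = prod_list (diag_mat D)"
      using car by (intro det_upper_triangular) (auto simp: D_def upper_triangular_def)
    also have "\<dots> = (\<Prod>l = 0..<r. D $$ (l, l))"
      using car by (simp add: prod_list_diag_prod)
    finally show ?thesis by (simp add: D_def atLeast0LessThan)
  qed
  also have "det \<Delta> = (\<Prod>l<r. d l ^ s l)"
  proof -
    have "det \<Delta> = prod_list (diag_mat \<Delta>)"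
      using car by (intro det_upper_triangular) (auto simp: \<Delta>_def upper_triangular_def)
    also have "\<dots> = (\<Prod>i<N. d (c i))"
      using car by (simp add: prod_list_diag_prod \<Delta>_def atLeast0LessThan)
    also have "\<dots> = (\<Prod>l<r. \<Prod>i | i \<in> {..<N} \<and> c i = l. d (c i))"
      using c by (intro prod.group[symmetric]) auto
    also have "\<dots> = (\<Prod>l<r. d l ^ s l)"
      by (intro prod.cong) (auto simp: s_def)
    finally show ?thesis .
  qed
  finally show ?thesis .
qed

section \<open>The quotient determinant\<close>

text \<open>
  Cofactor expansion on lists of rows, along the first column.  On a literal matrix its equations
  rewrite the determinant to a ring expression.
\<close>

primrec deletions :: "'b list \<Rightarrow> 'b list list" where
  "deletions [] = []"
| "deletions (x # xs) = xs # map (Cons x) (deletions xs)"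

fun alternating_sum :: "'a::comm_ring_1 list \<Rightarrow> 'a list \<Rightarrow> 'a" where
  "alternating_sum (x # xs) (y # ys) = x * y - alternating_sum xs ys"
| "alternating_sum _ _ = 0"

primrec laplace :: "nat \<Rightarrow> 'a::comm_ring_1 list list \<Rightarrow> 'a" where
  "laplace 0 rs = 1"
| "laplace (Suc n) rs =
     alternating_sum (map hd rs) (map (\<lambda>m. laplace n (map tl m)) (deletions rs))"

lemma length_deletions [simp]: "length (deletions xs) = length xs"
  by (induction xs) auto

lemma nth_deletions: "i < length xs \<Longrightarrow> deletions xs ! i = take i xs @ drop (Suc i) xs"
  by (induction xs arbitrary: i) (auto simp: nth_Cons split: nat.splits)

lemma alternating_sum_eq_sum:
  "length xs = length ys \<Longrightarrow>
    alternating_sum xs ys = (\<Sum>i<length xs. (- 1) ^ i * xs ! i * ys ! i)"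
  by (induction xs ys rule: list_induct2)
    (simp_all add: sum.lessThan_Suc_shift sum_negf del: sum.lessThan_Suc)

lemma det_eq_laplace:
  fixes rs :: "'a::comm_ring_1 list list"
  assumes "length rs = n" "\<forall>r\<in>set rs. length r = n"
  shows "det (mat n n (\<lambda>(i, j). rs ! i ! j)) = laplace n rs"
  using assms
proof (induction n arbitrary: rs)
  case 0
  then show ?case by simp
next
  case (Suc n)
  let ?A = "mat (Suc n) (Suc n) (\<lambda>(i, j). rs ! i ! j)"
  let ?m = "\<lambda>i. map tl (take i rs @ drop (Suc i) rs)"
  have len: "length (rs ! i) = Suc n" if "i < Suc n" for i
    using Suc.prems that by auto
  have minor: "det (mat_delete ?A i 0) = laplace n (?m i)" if i: "i < Suc n" for i
  proof -
    have "mat_delete ?A i 0 = mat n n (\<lambda>(a, b). ?m i ! a ! b)"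
      using i Suc.prems(1) len
      by (intro eq_matI) (auto simp: mat_delete_def nth_append nth_tl)
    also have "det \<dots> = laplace n (?m i)"
      using i Suc.prems by (intro Suc.IH) (auto dest: in_set_takeD in_set_dropD)
    finally show ?thesis .
  qed
  have "det ?A = (\<Sum>i<Suc n. ?A $$ (i, 0) * cofactor ?A i 0)"
    by (rule laplace_expansion_column[where n = "Suc n"]) auto
  also have "\<dots> = (\<Sum>i<Suc n. (- 1) ^ i * map hd rs ! i *
      map (\<lambda>m. laplace n (map tl m)) (deletions rs) ! i)"
  proof (rule sum.cong[OF refl])
    fix i assume "i \<in> {..<Suc n}"
    then have i: "i < Suc n" by simp
    then have "rs ! i ! 0 = hd (rs ! i)"
      using len[OF i] by (cases "rs ! i") auto
    with i Suc.prems(1) minor[OF i] show "?A $$ (i, 0) * cofactor ?A i 0 = (- 1) ^ i * map hd rs ! i *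
        map (\<lambda>m. laplace n (map tl m)) (deletions rs) ! i"
      by (simp add: cofactor_def nth_deletions)
  qed
  also have "\<dots> = laplace (Suc n) rs"
    using Suc.prems(1) by (simp add: alternating_sum_eq_sum del: sum.lessThan_Suc)
  finally show ?case .
qed

lemma det_torch_quotient:
  fixes x k :: "'a::comm_ring_1"
  shows "det (mat 6 6 (\<lambda>(i, j). (if i = j then x + of_nat (torch_quotient ! i ! i) else 0)
      - of_nat (torch_quotient ! i ! j) * [1, k - 3, 1, 1, 2, 2] ! j))
    = x ^ 6 - (2 * k - 5) * x ^ 5 - (43 * k - 63) * x ^ 4 - (123 * k - 103) * x ^ 3
      - (76 * k + 174) * x ^ 2 + (10 * k - 276) * x + (12 * k - 88)"
    (is "det (mat 6 6 ?f) = ?p")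
proof -
  let ?rs = "[[x, - 2 * (k - 3), - 2, - 1, - 2, - 2],
    [- 2, x + 2 - 2 * (k - 3), - 4, - 3, - 2, - 6],
    [- 2, - 4 * (k - 3), x, - 1, - 6, - 4],
    [- 1, - 3 * (k - 3), - 1, x, - 4, - 2],
    [- 1, - (k - 3), - 3, - 2, x - 1, - 4],
    [- 1, - 3 * (k - 3), - 2, - 1, - 4, x - 2]]"
  have "mat 6 6 ?f = mat 6 6 (\<lambda>(i, j). ?rs ! i ! j)"
  proof (rule eq_matI)
    fix i j :: nat
    assume "i < dim_row (mat 6 6 (\<lambda>(i, j). ?rs ! i ! j))"
      and "j < dim_col (mat 6 6 (\<lambda>(i, j). ?rs ! i ! j))"
    then have ij: "i < 6" "j < 6" by auto
    then have "i = 0 \<or> i = 1 \<or> i = 2 \<or> i = 3 \<or> i = 4 \<or> i = 5"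
      and "j = 0 \<or> j = 1 \<or> j = 2 \<or> j = 3 \<or> j = 4 \<or> j = 5"
      by linarith+
    then show "mat 6 6 ?f $$ (i, j) = mat 6 6 (\<lambda>(i, j). ?rs ! i ! j) $$ (i, j)"
      by (elim disjE) (simp_all add: torch_quotient_def)
  qed auto
  then have "det (mat 6 6 ?f) = laplace 6 ?rs"
    by (simp only:) (rule det_eq_laplace; simp)
  also have "\<dots> = laplace (Suc (Suc (Suc (Suc (Suc (Suc 0)))))) ?rs"
    by (rule arg_cong[where f = "\<lambda>m. laplace m ?rs"]) simp
  also have "\<dots> = ?p"
    by (simp only: laplace.simps deletions.simps list.map list.sel alternating_sum.simps
        mult_1_right diff_0_right) (simp add: algebra_simps power_numeral_reduce)
  finally show ?thesis .
qed

section \<open>From the quotient to the spectrum\<close>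

lemma eigenvalues_mset_eq_proots:
  assumes A: "A \<in> carrier_mat N N"
  shows "eigenvalues_mset A = proots (char_poly A)"
proof (rule multiset_eqI)
  fix a
  have nz: "char_poly A \<noteq> 0"
    using degree_monic_char_poly[OF A] by auto
  have fin: "finite (spectrum A)"
    using card_finite_spectrum(1)[OF A] .
  have "count (eigenvalues_mset A) a
      = (\<Sum>b\<in>spectrum A. if b = a then order a (char_poly A) else 0)"
    unfolding eigenvalues_mset_def count_sum by (intro sum.cong) auto
  also have "\<dots> = order a (char_poly A)"
    using fin nz by (simp add: spectrum_root_char_poly[OF A] order_root)
  finally show "count (eigenvalues_mset A) a = count (proots (char_poly A)) a"
    using nz by simp
qed

lemma char_poly_torch_graph:
  assumes n: "n \<ge> 4"
  defines "X \<equiv> [:0, 1:] :: complex poly"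
  shows "char_poly (map_mat complex_of_real (distance_matrix (torch_graph n))) =
    (X + 2) ^ (n - 3) * (X + 1) *
    (X ^ 6 - (2 * of_nat n - 5) * X ^ 5 - (43 * of_nat n - 63) * X ^ 4
      - (123 * of_nat n - 103) * X ^ 3 - (76 * of_nat n + 174) * X ^ 2
      + (10 * of_nat n - 276) * X + (12 * of_nat n - 88))"
    (is "char_poly ?A = _ * _ * ?p")
proof -
  define c where "c i = torch_class n (Suc i)" for i
  define M where "M k l = (of_nat (torch_quotient ! k ! l) :: complex poly)" for k l
  define d where "d k = X + M k k" for k
  define s where "s l = card {i. i < n + 4 \<and> c i = l}" for l
  have s: "s l = [1, n - 3, 1, 1, 2, 2] ! l" if "l < 6" for l
    using card_torch_class[OF n that] by (simp add: s_def c_def)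
  have six: "{..<6} = {0, 1, 2, 3, 4, 5 :: nat}"
    by auto
  have "char_poly_matrix ?A
      = mat (n + 4) (n + 4) (\<lambda>(i, j). (if i = j then d (c i) else 0) - M (c i) (c j))"
    by (rule eq_matI)
      (auto simp: char_poly_matrix_def distance_matrix_torch_graph[OF n] torch_dist_def
        c_def d_def M_def X_def of_nat_poly)
  then have "(\<Prod>l<6. d l) * char_poly ?A = (\<Prod>l<6. d l ^ s l) *
      det (mat 6 6 (\<lambda>(k, l). (if k = l then d k else 0) - M k l * of_nat (s l)))"
    unfolding char_poly_def s_def
    by (simp only:) (rule det_twin_classes, simp add: c_def torch_class_less)
  also have "mat 6 6 (\<lambda>(k, l). (if k = l then d k else 0) - M k l * of_nat (s l))
      = mat 6 6 (\<lambda>(i, j). (if i = j then X + of_nat (torch_quotient ! i ! i) else 0)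
        - of_nat (torch_quotient ! i ! j) * [1, of_nat n - 3, 1, 1, 2, 2] ! j)"
  proof (rule eq_matI, goal_cases)
    case (1 i j)
    then have "j = 0 \<or> j = 1 \<or> j = 2 \<or> j = 3 \<or> j = 4 \<or> j = 5"
      by auto
    then have "of_nat (s j) = ([1, of_nat n - 3, 1, 1, 2, 2] ! j :: complex poly)"
      using n by (elim disjE) (simp_all add: s of_nat_diff)
    with 1 show ?case by (simp add: d_def M_def)
  qed auto
  also have "det \<dots> = ?p"
    by (rule det_torch_quotient)
  also have "(\<Prod>l<6. d l) = X ^ 3 * (X + 2) ^ 2 * (X + 1)"
    unfolding six by (simp add: d_def M_def torch_quotient_def power_numeral_reduce algebra_simps)
  also have "(\<Prod>l<6. d l ^ s l) = X ^ 3 * (X + 2) ^ 2 * (X + 1) * ((X + 2) ^ (n - 3) * (X + 1))"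
    unfolding six
    by (simp add: s d_def M_def torch_quotient_def power_numeral_reduce mult_ac)
  finally have "X ^ 3 * (X + 2) ^ 2 * (X + 1) * char_poly ?A
      = X ^ 3 * (X + 2) ^ 2 * (X + 1) * ((X + 2) ^ (n - 3) * (X + 1) * ?p)"
    by (simp only: mult.assoc)
  moreover have "X \<noteq> 0" "X + 1 \<noteq> 0" "X + 2 \<noteq> 0"
    by (simp_all add: X_def numeral_poly one_pCons)
  then have "X ^ 3 * (X + 2) ^ 2 * (X + 1) \<noteq> 0"
    by (simp only: mult_eq_0_iff power_eq_0_iff) simp
  ultimately show ?thesis
    by (simp only: mult_cancel_left) simp
qed

theorem corollary4p5:
  fixes n :: nat
  assumes "n \<ge> 4"
  shows "distance_spectrum (torch_graph n) =
    replicate_mset (n - 3) (-2) + {#-1#} +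
    proots (monom 1 6
      - monom (2 * of_nat n - 5) 5
      - monom (43 * of_nat n - 63) 4
      - monom (123 * of_nat n - 103) 3
      - monom (76 * of_nat n + 174) 2
      + monom (10 * of_nat n - 276) 1
      + monom (12 * of_nat n - 88) 0)"
    (is "_ = _ + proots ?p")
proof -
  let ?A = "map_mat complex_of_real (distance_matrix (torch_graph n))"
  have A: "?A \<in> carrier_mat (n + 4) (n + 4)"
    by (simp add: distance_matrix_torch_graph[OF assms])
  have "char_poly ?A = [:2, 1:] ^ (n - 3) * [:1, 1:] * ?p"
  proof -
    have lin: "[:0, 1:] + 2 = [:2, 1 :: complex:]" "[:0, 1:] + 1 = [:1, 1 :: complex:]"
      by (simp_all add: numeral_poly one_pCons)
    show ?thesis
      unfolding char_poly_torch_graph[OF assms] lin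
      by (simp add: monom_altdef of_nat_poly numeral_poly mult.commute[of "of_nat n"])
  qed
  moreover have "?p \<noteq> 0"
  proof
    assume "?p = 0"
    then have "coeff ?p 6 = 0" by simp
    then show False by simp
  qed
  ultimately have "proots (char_poly ?A)
      = replicate_mset (n - 3) (-2) + {#-1#} + proots ?p"
    by (simp add: proots_mult proots_power repeat_mset_replicate_mset
        del: mult_pCons_left mult_pCons_right)
  then show ?thesis
    by (simp add: distance_spectrum_def eigenvalues_mset_eq_proots[OF A])
qed

end
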